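(* Let $e_1,e_2,e_3,\dots$ be a sequence with $e_i\in\{-1,1\}$, and for $n\ge1$ let ${\bf e}(n)=(e_n,\dots,e_2,e_1,e_1,e_2,\dots,e_n)$. Let $f_n=f_{{\bf e}(n)}$ (the Riley polynomial of the kmot group $G({\bf e}(n))$) and $g_n=g_{{\bf e}(n)}$, with $f_0=1$, $g_0=0$. Then (i) $f_n=M^{2e_n}f_{n-2}+(\tilde\lambda+1-M^{2e_n})f_{n-1}+e_n\tilde\lambda(M+M^{-1})\bar g_{n-1}$ for all $n\ge2$, and $g_n=e_nM^{-e_n}f_{n-1}+M^{-2e_n}\bar g_{n-1}$ for all $n\ge1$; or equivalently (ii) $f_n=(\tilde\lambda+1-M^{2e_n})f_{n-1}+M^{2e_n}f_{n-2}+\tilde\lambda(M+M^{-1})\sum_{i=1}^{n-1}e_ne_iM^{\mu_i+2e_n}f_{i-1}$ for all $n\ge2$, and $g_n=\sum_{i=1}^{n}e_iM^{\mu_i}f_{i-1}$ for all $n\ge1$, where $\mu_i=(-1)^{n-i}e_i-2\sum_{j=i}^{n}(-1)^{n-j}e_j$.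
   Context: $M,\lambda$ are indeterminates, $z=M-M^{-1}$, $\tilde\lambda=\lambda+z^2$. For $g=g(M,\tilde\lambda)$, $\bar g(M,\tilde\lambda):=g(M^{-1},\tilde\lambda)$. For $N\ge 0$, $0\le k\le N$ and signs $\epsilon_1,\dots,\epsilon_N$, define $$\tilde c_k^N(M,\epsilon)=\sum \epsilon_{i_1}\cdots\epsilon_{i_k}M^{\widehat{i_1\cdots i_k}^{alt}},$$ the sum being over $0<i_1<\cdots<i_k\le N$ with $i_j$ odd for $j$ odd and $i_j$ even for $j$ even; if $j_1<\cdots<j_{N-k}$ are the elements of $\{1,\dots,N\}\setminus\{i_1,\dots,i_k\}$, then $\widehat{i_1\cdots i_k}^{alt}=\sum_{r=1}^{N-k}(-1)^r\epsilon_{j_r}$. For a symmetric sign sequence $\epsilon=(\epsilon_1,\dots,\epsilon_{2n})$ ($\epsilon_i=\epsilon_{2n+1-i}$) set $$f_\epsilon(M,\tilde\lambda)=\sum_{k=0}^{n}\tilde c_{2k}^{2n}(M,\epsilon)\tilde\lambda^k,\qquad g_\epsilon(M,\tilde\lambda)=\sum_{k=0}^{n-1}\tilde c_{2k+1}^{2n}(M,\epsilon)\tilde\lambda^k .$$ The kmot group $G(\epsilon)$ is $\langle x,y\mid wx=yw\rangle$, $w=x^{\epsilon_1}y^{\epsilon_2}\cdots x^{\epsilon_{2n-1}}y^{\epsilon_{2n}}$; its Riley polynomial is $W_{11}-zW_{12}$, where $W$ is the matrix obtained from $w$ by substituting $x\mapsto\begin{pmatrix}M&1\\0&M^{-1}\end{pmatrix}$,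 $y\mapsto\begin{pmatrix}M&0\\ \lambda&M^{-1}\end{pmatrix}$, and it equals $f_\epsilon(M,\tilde\lambda)$. *)

theory Defs
  imports "HOL-Analysis.Cartesian_Space" "HOL-Library.Poly_Mapping" "HOL-Computational_Algebra.Polynomial"
begin

text \<open>
  \<^typ>\<open>int \<Rightarrow>\<^sub>0 int\<close> with the convolution product of \<^theory>\<open>HOL-Library.Poly_Mapping\<close> is the ring of
  Laurent polynomials in \<open>M\<close> over the integers (the keys are the exponents), and all computations
  take place in the polynomial ring over it in the variable \<open>\<lambda>\<^sup>~ = \<lambda> + (M - M\<^sup>-\<^sup>1)\<^sup>2\<close>.
\<close>

type_synonym laurent = "int \<Rightarrow>\<^sub>0 int"

definition M_pow :: "int \<Rightarrow> laurent poly"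
  where "M_pow k = [:Poly_Mapping.single k 1:]"

definition lam_tilde :: "laurent poly"
  where "lam_tilde = [:0, 1:]"

definition zz :: "laurent poly"
  where "zz = M_pow 1 - M_pow (-1)"

definition lam :: "laurent poly"
  where "lam = lam_tilde - zz\<^sup>2"

text \<open>The involution \<open>g(M, \<lambda>\<^sup>~) \<mapsto> g(M\<^sup>-\<^sup>1, \<lambda>\<^sup>~)\<close>: the exponents of \<open>M\<close> change sign and \<open>\<lambda>\<^sup>~\<close> is fixed.\<close>

definition bar :: "laurent poly \<Rightarrow> laurent poly"
  where "bar = map_poly (Poly_Mapping.map_key uminus)"

lemma bar_M_pow: "bar (M_pow k) = M_pow (- k)"
proof -
  have "Poly_Mapping.map_key uminus (Poly_Mapping.single k (1 :: int)) = Poly_Mapping.single (- k) 1"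
    by (rule poly_mapping_eqI) (auto simp: map_key.rep_eq lookup_single when_def)
  then show ?thesis by (simp add: bar_def M_pow_def map_poly_pCons)
qed

text \<open>
  A sign sequence of length \<open>N\<close> is given by the values of a function at \<open>1, \<dots>, N\<close>. The index tuple
  \<open>i\<^sub>1 < \<dots> < i\<^sub>k\<close> is encoded by the set of its entries; \<^const>\<open>sorted_list_of_set\<close> recovers the
  tuple, whose entry \<open>i\<^sub>j\<close> sits at list position \<open>j - 1\<close>.
\<close>

definition alt_sets :: "nat \<Rightarrow> nat \<Rightarrow> nat set set"
  where "alt_sets N k = {I. I \<subseteq> {1..N} \<and> card I = k \<and>
    (\<forall>j\<in>{1..k}. odd (sorted_list_of_set I ! (j - 1)) \<longleftrightarrow> odd j)}"

definition alt_exponent :: "nat \<Rightarrow> (nat \<Rightarrow> int) \<Rightarrow> nat set \<Rightarrow> int"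
  where "alt_exponent N \<epsilon> I =
    (\<Sum>r=1..N - card I. (-1) ^ r * \<epsilon> (sorted_list_of_set ({1..N} - I) ! (r - 1)))"

definition c_tilde :: "nat \<Rightarrow> nat \<Rightarrow> (nat \<Rightarrow> int) \<Rightarrow> laurent"
  where "c_tilde N k \<epsilon> =
    (\<Sum>I\<in>alt_sets N k. Poly_Mapping.single (alt_exponent N \<epsilon> I) (\<Prod>i\<in>I. \<epsilon> i))"

definition f_eps :: "nat \<Rightarrow> (nat \<Rightarrow> int) \<Rightarrow> laurent poly"
  where "f_eps n \<epsilon> = (\<Sum>k=0..n. [:c_tilde (2 * n) (2 * k) \<epsilon>:] * lam_tilde ^ k)"

definition g_eps :: "nat \<Rightarrow> (nat \<Rightarrow> int) \<Rightarrow> laurent poly"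
  where "g_eps n \<epsilon> = (\<Sum>k<n. [:c_tilde (2 * n) (2 * k + 1) \<epsilon>:] * lam_tilde ^ k)"

text \<open>The sequence \<open>(e\<^sub>n, \<dots>, e\<^sub>1, e\<^sub>1, \<dots>, e\<^sub>n)\<close>, indexed from \<open>1\<close>; the value \<open>e 0\<close> is not used.\<close>

definition sym_seq :: "(nat \<Rightarrow> int) \<Rightarrow> nat \<Rightarrow> nat \<Rightarrow> int"
  where "sym_seq e n i = (if i \<le> n then e (n + 1 - i) else e (i - n))"

text \<open>
  For \<open>n = 0\<close> these two definitions give the initial values \<open>1\<close> and \<open>0\<close>; see \<open>f_seq_0\<close> and
  \<open>g_seq_0\<close> below.
\<close>

definition f_seq :: "(nat \<Rightarrow> int) \<Rightarrow> nat \<Rightarrow> laurent poly"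
  where "f_seq e n = f_eps n (sym_seq e n)"

definition g_seq :: "(nat \<Rightarrow> int) \<Rightarrow> nat \<Rightarrow> laurent poly"
  where "g_seq e n = g_eps n (sym_seq e n)"

definition mu :: "(nat \<Rightarrow> int) \<Rightarrow> nat \<Rightarrow> nat \<Rightarrow> int"
  where "mu e n i = (-1) ^ (n - i) * e i - 2 * (\<Sum>j=i..n. (-1) ^ (n - j) * e j)"


section \<open>The Riley polynomial of a kmot group\<close>

definition mat_x :: "laurent poly ^ 2 ^ 2"
  where "mat_x = vector [vector [M_pow 1, 1], vector [0, M_pow (-1)]]"

definition mat_y :: "laurent poly ^ 2 ^ 2"
  where "mat_y = vector [vector [M_pow 1, 0], vector [lam, M_pow (-1)]]"

definition sign_pow :: "laurent poly ^ 2 ^ 2 \<Rightarrow> int \<Rightarrow> laurent poly ^ 2 ^ 2"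
  where "sign_pow A s = (if s = 1 then A else matrix_inv A)"

text \<open>The image of \<open>x\<^bsup>\<epsilon>\<^sub>1\<^esup> y\<^bsup>\<epsilon>\<^sub>2\<^esup> \<cdots> x\<^bsup>\<epsilon>\<^sub>2\<^sub>n\<^sub>-\<^sub>1\<^esup> y\<^bsup>\<epsilon>\<^sub>2\<^sub>n\<^esup>\<close>.\<close>

fun word_mat :: "nat \<Rightarrow> (nat \<Rightarrow> int) \<Rightarrow> laurent poly ^ 2 ^ 2"
  where
    "word_mat 0 \<epsilon> = mat 1"
  | "word_mat (Suc n) \<epsilon> =
      word_mat n \<epsilon> ** sign_pow mat_x (\<epsilon> (2 * n + 1)) ** sign_pow mat_y (\<epsilon> (2 * n + 2))"

definition riley_poly :: "nat \<Rightarrow> (nat \<Rightarrow> int) \<Rightarrow> laurent poly"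
  where "riley_poly n \<epsilon> = word_mat n \<epsilon> $ 1 $ 1 - zz * word_mat n \<epsilon> $ 1 $ 2"

lemma f_eps_0: "f_eps 0 \<epsilon> = 1"
proof -
  have "alt_sets 0 0 = {{}}" by (auto simp: alt_sets_def)
  then show ?thesis
    by (simp add: f_eps_def c_tilde_def alt_exponent_def one_pCons)
qed

lemma f_seq_0: "f_seq e 0 = 1"
  by (simp add: f_seq_def f_eps_0)

lemma g_seq_0: "g_seq e 0 = 0"
  by (simp add: g_seq_def g_eps_def)

text \<open>
  The Riley polynomial of \<open>G(\<epsilon>)\<close> is \<^const>\<open>f_eps\<close>; see \<open>riley_poly_eq_f_eps\<close> at the end, which holds
  for every sign sequence of even length, symmetric or not.
\<close>

lemma M_pow_0: "M_pow 0 = 1"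
  by (simp add: M_pow_def one_pCons)

lemma M_pow_mult: "M_pow a * M_pow b = M_pow (a + b)"
  by (simp add: M_pow_def mult_single add.commute)

lemma matrix_inv_eqI:
  fixes A B :: "laurent poly ^ 2 ^ 2"
  assumes "A ** B = mat 1" "B ** A = mat 1"
  shows "matrix_inv A = B"
proof -
  have right: "A ** matrix_inv A = mat 1 \<and> matrix_inv A ** A = mat 1"
    unfolding matrix_inv_def by (rule someI[of _ B]) (use assms in simp)
  have "matrix_inv A = (B ** A) ** matrix_inv A"
    unfolding assms(2) by (rule matrix_mul_lid[symmetric])
  also have "\<dots> = B ** (A ** matrix_inv A)"
    by (rule matrix_mul_assoc[symmetric])
  also have "\<dots> = B"
    using right by (simp add: matrix_mul_rid)
  finally show ?thesis .
qed

lemma mat2_eq_iff: "(A :: 'a ^ 2 ^ 2) = B \<longleftrightarrow>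
    A $ 1 $ 1 = B $ 1 $ 1 \<and> A $ 1 $ 2 = B $ 1 $ 2 \<and> A $ 2 $ 1 = B $ 2 $ 1 \<and> A $ 2 $ 2 = B $ 2 $ 2"
  by (auto simp: vec_eq_iff forall_2)

lemma mult2_nth: "((A :: laurent poly ^ 2 ^ 2) ** B) $ i $ j = A $ i $ 1 * B $ 1 $ j + A $ i $ 2 * B $ 2 $ j"
  by (simp add: matrix_matrix_mult_def sum_2)

lemma mat_x_inv: "matrix_inv mat_x = vector [vector [M_pow (-1), -1], vector [0, M_pow 1]]"
  by (rule matrix_inv_eqI) (simp_all add: mat2_eq_iff mult2_nth mat_x_def mat_def M_pow_mult M_pow_0)

lemma mat_y_inv: "matrix_inv mat_y = vector [vector [M_pow (-1), 0], vector [-lam, M_pow 1]]"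
  by (rule matrix_inv_eqI)
    (simp_all add: mat2_eq_iff mult2_nth mat_y_def mat_def M_pow_mult M_pow_0 mult.commute)

lemma sign_pow_mat_x:
  assumes "s \<in> {-1, 1}"
  shows "sign_pow mat_x s = vector [vector [M_pow s, of_int s], vector [0, M_pow (-s)]]"
  using assms by (auto simp: sign_pow_def mat_x_inv) (simp add: mat_x_def)

lemma sign_pow_mat_y:
  assumes "s \<in> {-1, 1}"
  shows "sign_pow mat_y s = vector [vector [M_pow s, 0], vector [of_int s * lam, M_pow (-s)]]"
  using assms by (auto simp: sign_pow_def mat_y_inv) (simp add: mat_y_def)

lemma sorted_list_of_set_snoc:
  assumes "A \<subseteq> {1..N}"
  shows "sorted_list_of_set (insert (Suc N) A) = sorted_list_of_set A @ [Suc N]"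
proof -
  have fin: "finite A" using assms finite_subset by blast
  have "Suc N \<notin> A" using assms by auto
  moreover have "\<forall>x\<in>set (sorted_list_of_set A). x \<le> Suc N" using assms fin by fastforce
  ultimately show ?thesis
    using fin by (simp add: sorted_insort_is_snoc)
qed

lemma alt_sets_Suc_notin:
  "{I \<in> alt_sets (Suc N) k. Suc N \<notin> I} = alt_sets N k"
  by (auto simp: alt_sets_def atLeastAtMostSuc_conv)

lemma alt_sets_Suc_in:
  "{I \<in> alt_sets (Suc N) k. Suc N \<in> I} =
    (if k \<ge> 1 \<and> (odd (Suc N) \<longleftrightarrow> odd k) then insert (Suc N) ` alt_sets N (k - 1) else {})"
proof -
  have key: "insert (Suc N) I \<in> alt_sets (Suc N) k \<longleftrightarrow>
      k \<ge> 1 \<and> (odd (Suc N) \<longleftrightarrow> odd k) \<and> I \<in> alt_sets N (k - 1)" if I: "I \<subseteq> {1..N}" for I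
  proof -
    have fin: "finite I" using I finite_subset by blast
    have notin: "Suc N \<notin> I" using I by auto
    show ?thesis
    proof (cases "k \<ge> 1 \<and> card I = k - 1")
      case False
      then show ?thesis using fin notin by (auto simp: alt_sets_def)
    next
      case True
      then have k: "k = Suc (card I)" by auto
      have len: "length (sorted_list_of_set I) = card I" using fin by simp
      have ivl: "{1..k} = insert k {1..card I}"
        unfolding k by (rule atLeastAtMostSuc_conv) simp
      have last: "(sorted_list_of_set I @ [Suc N]) ! (k - 1) = Suc N"
        unfolding k using len by (simp add: nth_append)
      have init: "(sorted_list_of_set I @ [Suc N]) ! (j - 1) = sorted_list_of_set I ! (j - 1)"
        if "j \<in> {1..card I}" for j
        using that len by (auto simp: nth_append)
      have "(\<forall>j\<in>{1..k}. odd (sorted_list_of_set (insert (Suc N) I) ! (j - 1)) \<longleftrightarrow> odd j) \<longleftrightarrow>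
          (odd (Suc N) \<longleftrightarrow> odd k) \<and>
          (\<forall>j\<in>{1..card I}. odd (sorted_list_of_set I ! (j - 1)) \<longleftrightarrow> odd j)"
        unfolding sorted_list_of_set_snoc[OF I] ivl ball_simps last using init by (simp cong: ball_cong_simp)
      moreover have "insert (Suc N) I \<subseteq> {1..Suc N}" "card (insert (Suc N) I) = k"
          "k \<ge> 1" "card I = k - 1"
        unfolding k using I fin notin by auto
      moreover have "{1..card I} = {1..k - 1}" using k by simp
      ultimately show ?thesis using I
        unfolding alt_sets_def by simp
    qed
  qed
  have sub: "I - {Suc N} \<subseteq> {1..N}" if "I \<in> alt_sets (Suc N) k" for I
    using that by (auto simp: alt_sets_def atLeastAtMostSuc_conv)
  have sub': "I \<subseteq> {1..N}" if "I \<in> alt_sets N l" for I l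
    using that by (auto simp: alt_sets_def)
  show ?thesis
  proof (intro set_eqI iffI)
    fix I assume I: "I \<in> {I \<in> alt_sets (Suc N) k. Suc N \<in> I}"
    then have eq: "I = insert (Suc N) (I - {Suc N})" by auto
    have "insert (Suc N) (I - {Suc N}) \<in> alt_sets (Suc N) k" using I by (simp add: insert_absorb)
    with key[of "I - {Suc N}"] sub[of I] I
    have "k \<ge> 1 \<and> (odd (Suc N) \<longleftrightarrow> odd k)" "I - {Suc N} \<in> alt_sets N (k - 1)"
      by blast+
    then show "I \<in> (if k \<ge> 1 \<and> (odd (Suc N) \<longleftrightarrow> odd k) then insert (Suc N) ` alt_sets N (k - 1) else {})"
      using image_eqI[of I "insert (Suc N)" "I - {Suc N}", OF eq] by simp
  next
    fix I assume I: "I \<in> (if k \<ge> 1 \<and> (odd (Suc N) \<longleftrightarrow> odd k) then insert (Suc N) ` alt_sets N (k - 1) else {})"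
    then show "I \<in> {I \<in> alt_sets (Suc N) k. Suc N \<in> I}"
      using key sub' by (auto split: if_splits)
  qed
qed

lemma alt_exponent_Suc_in:
  assumes "I \<subseteq> {1..N}"
  shows "alt_exponent (Suc N) \<epsilon> (insert (Suc N) I) = alt_exponent N \<epsilon> I"
proof -
  have "finite I" "Suc N \<notin> I" using assms finite_subset by auto
  moreover have "{1..Suc N} - insert (Suc N) I = {1..N} - I" by auto
  ultimately show ?thesis by (simp add: alt_exponent_def)
qed

lemma alt_exponent_Suc_notin:
  assumes "I \<subseteq> {1..N}" "card I = k"
  shows "alt_exponent (Suc N) \<epsilon> I = alt_exponent N \<epsilon> I + (-1) ^ (Suc N + k) * \<epsilon> (Suc N)"
proof -
  have fin: "finite I" using assms finite_subset by auto
  have "k \<le> N" using assms card_mono[of "{1..N}" I] by simp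
  then have Suc: "Suc N - k = Suc (N - k)" by simp
  have len: "length (sorted_list_of_set ({1..N} - I)) = N - k"
    using assms fin by (simp add: card_Diff_subset del: One_nat_def)
  have eq: "{1..Suc N} - I = insert (Suc N) ({1..N} - I)" using assms(1) by auto
  have snoc: "sorted_list_of_set ({1..Suc N} - I) = sorted_list_of_set ({1..N} - I) @ [Suc N]"
    unfolding eq by (rule sorted_list_of_set_snoc) auto
  have par: "(-1 :: int) ^ Suc (N - k) = (-1) ^ (Suc N + k)"
    using \<open>k \<le> N\<close> by (simp add: minus_one_power_iff)
  have "alt_exponent (Suc N) \<epsilon> I = (\<Sum>r=1..N - k. (-1) ^ r *
      \<epsilon> ((sorted_list_of_set ({1..N} - I) @ [Suc N]) ! (r - 1))) + (-1) ^ Suc (N - k) * \<epsilon> (Suc N)"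
    unfolding alt_exponent_def assms(2) Suc snoc
    by (subst sum.nat_ivl_Suc') (auto simp: nth_append len simp del: One_nat_def length_sorted_list_of_set)
  also have "(\<Sum>r=1..N - k. (-1) ^ r * \<epsilon> ((sorted_list_of_set ({1..N} - I) @ [Suc N]) ! (r - 1)))
      = alt_exponent N \<epsilon> I"
    unfolding alt_exponent_def assms(2) by (intro sum.cong) (auto simp: nth_append len simp del: One_nat_def length_sorted_list_of_set)
  finally show ?thesis by (simp only: par)
qed

lemma finite_alt_sets: "finite (alt_sets N k)"
  by (rule finite_subset[of _ "Pow {1..N}"]) (auto simp: alt_sets_def)

lemma c_tilde_Suc:
  "c_tilde (Suc N) k \<epsilon> =
    Poly_Mapping.single ((-1) ^ (Suc N + k) * \<epsilon> (Suc N)) 1 * c_tilde N k \<epsilon> +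
    (if k \<ge> 1 \<and> (odd (Suc N) \<longleftrightarrow> odd k)
     then Poly_Mapping.single 0 (\<epsilon> (Suc N)) * c_tilde N (k - 1) \<epsilon> else 0)"
proof -
  let ?t = "\<lambda>N I. Poly_Mapping.single (alt_exponent N \<epsilon> I) (\<Prod>i\<in>I. \<epsilon> i)"
  have "c_tilde (Suc N) k \<epsilon> = sum (?t (Suc N)) {I \<in> alt_sets (Suc N) k. Suc N \<notin> I} +
      sum (?t (Suc N)) {I \<in> alt_sets (Suc N) k. Suc N \<in> I}"
    unfolding c_tilde_def
    by (subst sum.union_disjoint[symmetric]) (auto simp: finite_alt_sets intro!: sum.cong)
  also have "sum (?t (Suc N)) {I \<in> alt_sets (Suc N) k. Suc N \<notin> I} =
      Poly_Mapping.single ((-1) ^ (Suc N + k) * \<epsilon> (Suc N)) 1 * c_tilde N k \<epsilon>"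
    unfolding alt_sets_Suc_notin c_tilde_def sum_distrib_left
  proof (rule sum.cong[OF refl])
    fix I assume "I \<in> alt_sets N k"
    then have "I \<subseteq> {1..N}" "card I = k" by (auto simp: alt_sets_def)
    from alt_exponent_Suc_notin[OF this, of \<epsilon>]
    show "?t (Suc N) I = Poly_Mapping.single ((-1) ^ (Suc N + k) * \<epsilon> (Suc N)) 1 * ?t N I"
      by (simp add: mult_single add.commute)
  qed
  also have "sum (?t (Suc N)) {I \<in> alt_sets (Suc N) k. Suc N \<in> I} =
      (if k \<ge> 1 \<and> (odd (Suc N) \<longleftrightarrow> odd k)
       then Poly_Mapping.single 0 (\<epsilon> (Suc N)) * c_tilde N (k - 1) \<epsilon> else 0)"
  proof -
    have notin: "Suc N \<notin> I" and sub: "I \<subseteq> {1..N}" and fin: "finite I"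
      if "I \<in> alt_sets N (k - 1)" for I
      using that finite_subset[of I "{1..N}"] by (auto simp: alt_sets_def)
    have inj: "inj_on (insert (Suc N)) (alt_sets N (k - 1))"
      using notin by (intro inj_onI) (metis insert_ident)
    have "sum (?t (Suc N)) (insert (Suc N) ` alt_sets N (k - 1)) =
        Poly_Mapping.single 0 (\<epsilon> (Suc N)) * c_tilde N (k - 1) \<epsilon>"
      unfolding sum.reindex[OF inj] c_tilde_def sum_distrib_left
      by (rule sum.cong[OF refl])
        (use notin sub fin in \<open>simp add: mult_single alt_exponent_Suc_in\<close>)
    then show ?thesis unfolding alt_sets_Suc_in by simp
  qed
  finally show ?thesis .
qed

lemma c_tilde_eq_0: "c_tilde N k \<epsilon> = 0" if "k > N"
proof -
  have "card I \<le> N" if "I \<subseteq> {1..N}" for I :: "nat set"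
    using card_mono[OF _ that] by simp
  then have "alt_sets N k = {}" using that by (auto simp: alt_sets_def not_less[symmetric])
  then show ?thesis by (simp add: c_tilde_def)
qed

lemma of_int_laurent: "(of_int s :: laurent poly) = [:Poly_Mapping.single 0 s:]"
  by (metis of_int_poly single_of_int of_int_eq_id id_apply)

lemma c_tilde_Suc_poly:
  "[:c_tilde (Suc N) k \<epsilon>:] =
    M_pow ((-1) ^ (Suc N + k) * \<epsilon> (Suc N)) * [:c_tilde N k \<epsilon>:] +
    (if k \<ge> 1 \<and> (odd (Suc N) \<longleftrightarrow> odd k)
     then of_int (\<epsilon> (Suc N)) * [:c_tilde N (k - 1) \<epsilon>:] else 0)"
  unfolding c_tilde_Suc M_pow_def of_int_laurent by simp

lemma c_tilde_odd_even:
  "[:c_tilde (Suc (2 * n)) (2 * k) \<epsilon>:] = M_pow (- \<epsilon> (2 * n + 1)) * [:c_tilde (2 * n) (2 * k) \<epsilon>:]"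
  unfolding c_tilde_Suc_poly by simp

lemma c_tilde_odd_odd:
  "[:c_tilde (Suc (2 * n)) (Suc (2 * k)) \<epsilon>:] =
    M_pow (\<epsilon> (2 * n + 1)) * [:c_tilde (2 * n) (Suc (2 * k)) \<epsilon>:] +
    of_int (\<epsilon> (2 * n + 1)) * [:c_tilde (2 * n) (2 * k) \<epsilon>:]"
  unfolding c_tilde_Suc_poly by simp

lemma c_tilde_even_odd:
  "[:c_tilde (Suc (Suc (2 * n))) (Suc (2 * k)) \<epsilon>:] =
    M_pow (- \<epsilon> (2 * n + 2)) * [:c_tilde (Suc (2 * n)) (Suc (2 * k)) \<epsilon>:]"
  unfolding c_tilde_Suc_poly[of "Suc (2 * n)"] by simp

lemma c_tilde_even_even:
  "[:c_tilde (Suc (Suc (2 * n))) (2 * k) \<epsilon>:] =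
    M_pow (\<epsilon> (2 * n + 2)) * [:c_tilde (Suc (2 * n)) (2 * k) \<epsilon>:] +
    (if k = 0 then 0 else
      of_int (\<epsilon> (2 * n + 2)) * [:c_tilde (Suc (2 * n)) (Suc (2 * (k - 1))) \<epsilon>:])"
proof (cases k)
  case 0
  then show ?thesis unfolding c_tilde_Suc_poly[of "Suc (2 * n)"] by simp
next
  case (Suc l)
  then show ?thesis unfolding c_tilde_Suc_poly[of "Suc (2 * n)"] by simp
qed

lemma f_eps_g_eps_Suc:
  fixes \<epsilon> :: "nat \<Rightarrow> int" and n :: nat
  defines "s \<equiv> \<epsilon> (2 * n + 1)" and "t \<equiv> \<epsilon> (2 * n + 2)"
  defines "b \<equiv> M_pow s * g_eps n \<epsilon> + of_int s * f_eps n \<epsilon>"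
  shows "f_eps (Suc n) \<epsilon> = M_pow t * (M_pow (-s) * f_eps n \<epsilon>) + of_int t * lam_tilde * b"
    and "g_eps (Suc n) \<epsilon> = M_pow (-t) * b"
proof -
  let ?C = "\<lambda>N k. [:c_tilde N k \<epsilon>:]"
  have last: "?C (2 * n) (Suc (2 * n)) = 0" by (simp add: c_tilde_eq_0)
  have g: "g_eps n \<epsilon> = (\<Sum>k\<le>n. ?C (2 * n) (Suc (2 * k)) * lam_tilde ^ k)"
    using last by (simp add: g_eps_def flip: lessThan_Suc_atMost)
  have f: "f_eps n \<epsilon> = (\<Sum>k\<le>n. ?C (2 * n) (2 * k) * lam_tilde ^ k)"
    by (simp add: f_eps_def atLeast0AtMost)
  have b: "b = (\<Sum>k\<le>n. ?C (Suc (2 * n)) (Suc (2 * k)) * lam_tilde ^ k)"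
    unfolding c_tilde_odd_odd b_def g f s_def t_def distrib_right sum.distrib
    by (simp add: sum_distrib_left mult.assoc)
  have a: "M_pow (-s) * f_eps n \<epsilon> = (\<Sum>k\<le>n. ?C (Suc (2 * n)) (2 * k) * lam_tilde ^ k)"
    unfolding c_tilde_odd_even f s_def by (simp add: sum_distrib_left mult.assoc)
  have top: "?C (Suc (2 * n)) (2 * Suc n) = 0" by (simp add: c_tilde_eq_0)
  have e: "2 * Suc n = Suc (Suc (2 * n))" by simp
  have "g_eps (Suc n) \<epsilon> = (\<Sum>k\<le>n. ?C (Suc (Suc (2 * n))) (Suc (2 * k)) * lam_tilde ^ k)"
    unfolding g_eps_def e lessThan_Suc_atMost by simp
  then show "g_eps (Suc n) \<epsilon> = M_pow (-t) * b"
    unfolding c_tilde_even_odd b t_def by (simp add: sum_distrib_left mult.assoc)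
  have "f_eps (Suc n) \<epsilon> = (\<Sum>k\<le>Suc n. ?C (Suc (Suc (2 * n))) (2 * k) * lam_tilde ^ k)"
    unfolding f_eps_def e atLeast0AtMost by simp
  also have "\<dots> = (\<Sum>k\<le>Suc n. M_pow t * (?C (Suc (2 * n)) (2 * k) * lam_tilde ^ k)) +
      (\<Sum>k\<le>Suc n. (if k = 0 then 0 else of_int t * ?C (Suc (2 * n)) (Suc (2 * (k - 1)))) * lam_tilde ^ k)"
    unfolding c_tilde_even_even distrib_right sum.distrib t_def by (simp only: mult.assoc)
  also have "(\<Sum>k\<le>Suc n. M_pow t * (?C (Suc (2 * n)) (2 * k) * lam_tilde ^ k)) =
      M_pow t * (M_pow (-s) * f_eps n \<epsilon>)"
    unfolding a sum_distrib_left using top by simp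
  also have "(\<Sum>k\<le>Suc n. (if k = 0 then 0 else of_int t * ?C (Suc (2 * n)) (Suc (2 * (k - 1)))) * lam_tilde ^ k)
      = (\<Sum>k\<le>n. of_int t * ?C (Suc (2 * n)) (Suc (2 * k)) * lam_tilde ^ Suc k)"
    by (subst sum.atMost_Suc_shift) simp
  also have "\<dots> = of_int t * lam_tilde * b"
    unfolding b sum_distrib_left by (rule sum.cong) (simp_all add: mult_ac)
  finally show "f_eps (Suc n) \<epsilon> = M_pow t * (M_pow (-s) * f_eps n \<epsilon>) + of_int t * lam_tilde * b" .
qed

theorem riley_poly_eq_f_eps:
  assumes "\<And>i. i \<in> {1..2 * n} \<Longrightarrow> \<epsilon> i \<in> {-1, 1}"
  shows "riley_poly n \<epsilon> = f_eps n \<epsilon>" and "word_mat n \<epsilon> $ 1 $ 2 = g_eps n \<epsilon>"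
proof -
  have "riley_poly n \<epsilon> = f_eps n \<epsilon> \<and> word_mat n \<epsilon> $ 1 $ 2 = g_eps n \<epsilon>"
    using assms
  proof (induction n)
    case 0
    show ?case by (simp add: riley_poly_def f_eps_0 g_eps_def mat_def)
  next
    case (Suc n)
    define s t where "s = \<epsilon> (2 * n + 1)" and "t = \<epsilon> (2 * n + 2)"
    have st: "s \<in> {-1, 1}" "t \<in> {-1, 1}" using Suc.prems by (auto simp: s_def t_def)
    have IH: "word_mat n \<epsilon> $ 1 $ 1 = f_eps n \<epsilon> + zz * g_eps n \<epsilon>"
        "word_mat n \<epsilon> $ 1 $ 2 = g_eps n \<epsilon>"
      using Suc.IH Suc.prems by (auto simp: riley_poly_def algebra_simps)
    have W: "word_mat (Suc n) \<epsilon> = word_mat n \<epsilon> ** sign_pow mat_x s ** sign_pow mat_y t"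
      by (simp add: s_def t_def)
    define b where "b = M_pow s * g_eps n \<epsilon> + of_int s * f_eps n \<epsilon>"
    have zz_s: "of_int s * zz = M_pow s - M_pow (-s)" "of_int t * zz = M_pow t - M_pow (-t)"
      using st by (auto simp: zz_def)
    have b12: "(f_eps n \<epsilon> + zz * g_eps n \<epsilon>) * of_int s + g_eps n \<epsilon> * M_pow (-s) = b"
      using zz_s(1) unfolding b_def by algebra
    have W12: "word_mat (Suc n) \<epsilon> $ 1 $ 2 = M_pow (-t) * b"
      unfolding W mult2_nth sign_pow_mat_x[OF st(1)] sign_pow_mat_y[OF st(2)]
      by (simp add: IH b12)
    have W11: "word_mat (Suc n) \<epsilon> $ 1 $ 1 =
        (f_eps n \<epsilon> + zz * g_eps n \<epsilon>) * M_pow s * M_pow t + b * (of_int t * lam)"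
      unfolding W mult2_nth sign_pow_mat_x[OF st(1)] sign_pow_mat_y[OF st(2)]
      by (simp add: IH b12)
    have "of_int s * of_int s = (1 :: laurent poly)" "M_pow s * M_pow (-s) = 1"
      using st by (auto simp: M_pow_mult M_pow_0)
    then have "riley_poly (Suc n) \<epsilon> =
        M_pow t * (M_pow (-s) * f_eps n \<epsilon>) + of_int t * lam_tilde * b"
      using zz_s unfolding riley_poly_def W11 W12 lam_def b_def by algebra
    then show ?case
      using f_eps_g_eps_Suc[of n \<epsilon>] W12 by (simp add: s_def t_def b_def)
  qed
  then show "riley_poly n \<epsilon> = f_eps n \<epsilon>" "word_mat n \<epsilon> $ 1 $ 2 = g_eps n \<epsilon>" by auto
qed

end

theory Submission
  imports Defs
begin

text \<open>
  Appending one sign to a sequence acts linearly on the pair \<open>(f, g)\<close>, by a matrix \<open>X\<close> at odd and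
  \<open>Y\<close> at even positions. Write \<open>P\<^sub>n\<close> for the product of these matrices along \<open>e(n)\<close>, and \<open>Q\<^sub>n\<close> for
  the product with the roles of odd and even positions exchanged. Stripping the outermost signs gives
  \<open>P\<^sub>n = Y Q\<^sub>n\<^sub>-\<^sub>1 X\<close> and \<open>Q\<^sub>n = X P\<^sub>n\<^sub>-\<^sub>1 Y\<close>, and these recursions preserve the shape
  \<open>P\<^sub>n = ((f\<^sub>n, \<lambda>\<^sup>~ bar g\<^sub>n), (g\<^sub>n, f\<^sub>n\<^sub>-\<^sub>1))\<close>, \<open>Q\<^sub>n = ((f\<^sub>n\<^sub>-\<^sub>1, \<lambda>\<^sup>~ g\<^sub>n), (bar g\<^sub>n, f\<^sub>n))\<close> together with
  \<open>bar f\<^sub>n = f\<^sub>n\<close>. The entries yield the recursion for \<open>g\<^sub>n\<close> and one for \<open>f\<^sub>n\<close> that involves both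
  \<open>g\<^sub>n\<^sub>-\<^sub>1\<close> and \<open>bar g\<^sub>n\<^sub>-\<^sub>1\<close>; the identity \<open>z (f\<^sub>n - f\<^sub>n\<^sub>-\<^sub>1) = \<lambda>\<^sup>~ (bar g\<^sub>n - g\<^sub>n)\<close> eliminates \<open>g\<^sub>n\<^sub>-\<^sub>1\<close>.
\<close>

section \<open>The involution \<open>bar\<close> as a ring homomorphism\<close>

lemma lookup_map_key_uminus:
  "Poly_Mapping.lookup (Poly_Mapping.map_key uminus p) k = Poly_Mapping.lookup p (- k :: int)"
  by (simp add: map_key.rep_eq)

lemma map_key_uminus_single:
  "Poly_Mapping.map_key uminus (Poly_Mapping.single k c :: laurent) = Poly_Mapping.single (- k) c"
  by (rule poly_mapping_eqI) (auto simp: lookup_map_key_uminus lookup_single when_def)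

lemma map_key_uminus_sum:
  "Poly_Mapping.map_key uminus (sum f A :: laurent) = (\<Sum>a\<in>A. Poly_Mapping.map_key uminus (f a))"
  by (induction A rule: infinite_finite_induct) (simp_all add: map_key_zero map_key_plus)

text \<open>Both factors are expanded into monomials, where negating exponents respects their
  addition.\<close>

lemma map_key_uminus_mult:
  "Poly_Mapping.map_key uminus (p * q :: laurent)
    = Poly_Mapping.map_key uminus p * Poly_Mapping.map_key uminus q"
proof -
  let ?h = "Poly_Mapping.map_key uminus :: laurent \<Rightarrow> laurent"
  let ?s = "\<lambda>r k. Poly_Mapping.single k (Poly_Mapping.lookup r k) :: laurent"
  have expand: "(\<Sum>k\<in>Poly_Mapping.keys r. ?s r k) = r" for r
    by (rule poly_mapping_eqI)
      (auto simp: lookup_sum lookup_single when_def in_keys_iff)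
  have "?h ((\<Sum>k\<in>Poly_Mapping.keys p. ?s p k) * (\<Sum>k\<in>Poly_Mapping.keys q. ?s q k))
      = ?h (\<Sum>k\<in>Poly_Mapping.keys p. ?s p k) * ?h (\<Sum>k\<in>Poly_Mapping.keys q. ?s q k)"
    by (simp add: sum_product map_key_uminus_sum map_key_uminus_single mult_single)
  then show ?thesis by (simp only: expand)
qed

lemma bar_add: "bar (p + q) = bar p + bar q"
  by (rule poly_eqI) (simp add: bar_def coeff_map_poly map_key_zero map_key_plus)

lemma bar_mult: "bar (p * q) = bar p * bar q"
  by (rule poly_eqI)
    (simp add: bar_def coeff_map_poly coeff_mult map_key_zero map_key_uminus_sum map_key_uminus_mult)

lemma bar_0: "bar 0 = 0"
  by (simp add: bar_def)

lemma bar_sum: "bar (sum f A) = (\<Sum>a\<in>A. bar (f a))"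
  by (induction A rule: infinite_finite_induct) (simp_all add: bar_0 bar_add)

lemma bar_of_int: "bar (of_int s) = of_int s"
  by (simp add: of_int_laurent bar_def map_poly_pCons map_key_zero map_key_uminus_single)

lemma bar_lam_tilde: "bar lam_tilde = lam_tilde"
  using bar_of_int[of 1] by (simp add: lam_tilde_def bar_def map_poly_pCons map_key_zero one_pCons)

lemma bar_bar: "bar (bar p) = p"
  by (rule poly_eqI, rule poly_mapping_eqI)
    (simp add: bar_def coeff_map_poly map_key_zero lookup_map_key_uminus)

lemmas bar_simps = bar_add bar_mult bar_0 bar_of_int bar_lam_tilde bar_M_pow bar_bar

section \<open>Transfer matrices along a sign sequence\<close>

text \<open>The components collect index sets of even and of odd size. A newly chosen index at an
  odd position makes an even size odd; at an even position it makes an odd size even and costs a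
  factor \<open>lam_tilde\<close>.\<close>

fun transfer_step :: "nat \<Rightarrow> int \<Rightarrow> laurent poly \<times> laurent poly \<Rightarrow> laurent poly \<times> laurent poly"
  where "transfer_step k s (a, b) =
    (if odd k then (M_pow (- s) * a, of_int s * a + M_pow s * b)
     else (M_pow s * a + of_int s * lam_tilde * b, M_pow (- s) * b))"

text \<open>Here \<open>\<epsilon> i\<close> is treated as standing at position \<open>k + i\<close>, so only the parity of \<open>k\<close> matters.\<close>

primrec transfer :: "nat \<Rightarrow> (nat \<Rightarrow> int) \<Rightarrow> nat \<Rightarrow> laurent poly \<times> laurent poly
    \<Rightarrow> laurent poly \<times> laurent poly"
  where
    "transfer k \<epsilon> 0 v = v"
  | "transfer k \<epsilon> (Suc N) v = transfer_step (k + Suc N) (\<epsilon> (Suc N)) (transfer k \<epsilon> N v)"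

lemma transfer_Suc_front:
  "transfer k \<epsilon> (Suc N) v = transfer (Suc k) (\<lambda>i. \<epsilon> (Suc i)) N (transfer_step (Suc k) (\<epsilon> 1) v)"
  by (induction N) (simp_all del: transfer_step.simps)

lemma transfer_cong:
  "(\<And>i. i \<in> {1..N} \<Longrightarrow> \<epsilon> i = \<delta> i) \<Longrightarrow> transfer k \<epsilon> N v = transfer k \<delta> N v"
  by (induction N) (simp_all del: transfer_step.simps)

lemma transfer_f_eps_g_eps: "transfer 0 \<epsilon> (2 * n) (1, 0) = (f_eps n \<epsilon>, g_eps n \<epsilon>)"
proof (induction n)
  case 0
  show ?case by (simp add: f_eps_0 g_eps_def)
next
  case (Suc n)
  have "transfer 0 \<epsilon> (2 * Suc n) (1, 0)
      = transfer_step (Suc (Suc (2 * n))) (\<epsilon> (Suc (Suc (2 * n))))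
          (transfer_step (Suc (2 * n)) (\<epsilon> (Suc (2 * n))) (transfer 0 \<epsilon> (2 * n) (1, 0)))"
    by (simp del: transfer_step.simps)
  then show ?case
    unfolding Suc.IH f_eps_g_eps_Suc by (simp add: add.commute mult.assoc)
qed

section \<open>Products along symmetric sequences\<close>

text \<open>Without its two ends the sequence is the previous symmetric one, moved by one position;
  hence \<open>Suc k\<close>, which exchanges the two matrices.\<close>

lemma transfer_sym_seq_Suc:
  "transfer k (sym_seq e (Suc n)) (2 * Suc n) v
    = transfer_step (k + 2 * n + 2) (e (Suc n))
        (transfer (Suc k) (sym_seq e n) (2 * n) (transfer_step (Suc k) (e (Suc n)) v))"
proof -
  let ?\<epsilon> = "sym_seq e (Suc n)"
  have "transfer k ?\<epsilon> (2 * Suc n) v = transfer_step (k + Suc (Suc (2 * n))) (?\<epsilon> (Suc (Suc (2 * n))))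
      (transfer k ?\<epsilon> (Suc (2 * n)) v)"
    by (simp del: transfer_step.simps)
  also have "transfer k ?\<epsilon> (Suc (2 * n)) v
      = transfer (Suc k) (\<lambda>i. ?\<epsilon> (Suc i)) (2 * n) (transfer_step (Suc k) (?\<epsilon> 1) v)"
    by (rule transfer_Suc_front)
  also have "\<dots> = transfer (Suc k) (sym_seq e n) (2 * n) (transfer_step (Suc k) (?\<epsilon> 1) v)"
    by (rule transfer_cong) (auto simp: sym_seq_def Suc_diff_le)
  moreover have "?\<epsilon> 1 = e (Suc n)" "?\<epsilon> (Suc (Suc (2 * n))) = e (Suc n)"
    by (simp_all add: sym_seq_def)
  ultimately show ?thesis by simp
qed

text \<open>The truncated \<open>n - 1\<close> makes the matrices correct at \<open>n = 0\<close> too, as \<open>f\<^sub>0 = 1\<close>.\<close>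

lemma transfer_sym_seq:
  assumes signs: "\<forall>i\<ge>1. e i \<in> {-1, 1}"
  defines "f \<equiv> f_seq e" and "g \<equiv> g_seq e"
  shows "even k \<Longrightarrow> transfer k (sym_seq e n) (2 * n) (a, b)
      = (f n * a + lam_tilde * bar (g n) * b, g n * a + f (n - 1) * b)" (is "_ \<Longrightarrow> ?E n k a b")
    and "odd k \<Longrightarrow> transfer k (sym_seq e n) (2 * n) (a, b)
      = (f (n - 1) * a + lam_tilde * g n * b, bar (g n) * a + f n * b)" (is "_ \<Longrightarrow> ?O n k a b")
    and "bar (f n) = f n"
proof -
  \<comment> \<open>Each parity at \<open>Suc n\<close> rests on the other parity at
    \<open>n\<close>, and invariance of \<open>f (Suc n)\<close> rests on that of both
    \<open>f n\<close> and \<open>f (n - 1)\<close>.\<close>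
  let ?P = "\<lambda>n. (\<forall>k a b. (even k \<longrightarrow> ?E n k a b) \<and> (odd k \<longrightarrow> ?O n k a b))
    \<and> bar (f n) = f n \<and> bar (f (n - 1)) = f (n - 1)"
  have "?P n"
  proof (induction n)
    case 0
    show ?case
      using bar_of_int[of 1] by (simp add: f_def g_def f_seq_0 g_seq_0 bar_0)
  next
    case (Suc n)
    define s where "s = e (Suc n)"
    have s: "s \<in> {-1, 1}" using signs by (simp add: s_def)
    have inv: "M_pow s * M_pow (- s) = 1" and sq: "of_int s * of_int s = (1 :: laurent poly)"
      using s by (auto simp: M_pow_mult M_pow_0)
    have E: "transfer k (sym_seq e (Suc n)) (2 * Suc n) (a, b) =
        ((f (n - 1) + lam_tilde * f n
            + of_int s * lam_tilde * (M_pow s * g n + M_pow (- s) * bar (g n))) * a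
          + lam_tilde * (of_int s * M_pow s * f n + M_pow s * M_pow s * g n) * b,
         (of_int s * M_pow (- s) * f n + M_pow (- s) * M_pow (- s) * bar (g n)) * a + f n * b)" (is "_ = ?rhs")
      if "even k" for k a b
    proof -
      let ?l = "(M_pow s * (f (n - 1) * (M_pow (- s) * a) + lam_tilde * g n * (of_int s * a + M_pow s * b))
          + of_int s * lam_tilde * (bar (g n) * (M_pow (- s) * a) + f n * (of_int s * a + M_pow s * b)),
          M_pow (- s) * (bar (g n) * (M_pow (- s) * a) + f n * (of_int s * a + M_pow s * b)))"
      from that Suc.IH have "transfer k (sym_seq e (Suc n)) (2 * Suc n) (a, b) = ?l"
        unfolding transfer_sym_seq_Suc s_def[symmetric] by simp
      moreover have "fst ?l = fst ?rhs" "snd ?l = snd ?rhs"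
        unfolding fst_conv snd_conv using inv sq by algebra+
      ultimately show ?thesis by (simp only: prod_eq_iff)
    qed
    have O: "transfer k (sym_seq e (Suc n)) (2 * Suc n) (a, b) =
        (f n * a + lam_tilde
            * (of_int s * M_pow (- s) * f n + M_pow (- s) * M_pow (- s) * bar (g n)) * b,
         (of_int s * M_pow s * f n + M_pow s * M_pow s * g n) * a
          + (f (n - 1) + lam_tilde * f n
            + of_int s * lam_tilde * (M_pow s * g n + M_pow (- s) * bar (g n))) * b)" (is "_ = ?rhs")
      if "odd k" for k a b
    proof -
      let ?l = "(M_pow (- s) * (f n * (M_pow s * a + of_int s * lam_tilde * b) + lam_tilde * bar (g n) * (M_pow (- s) * b)),
          of_int s * (f n * (M_pow s * a + of_int s * lam_tilde * b) + lam_tilde * bar (g n) * (M_pow (- s) * b))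
          + M_pow s * (g n * (M_pow s * a + of_int s * lam_tilde * b) + f (n - 1) * (M_pow (- s) * b)))"
      from that Suc.IH have "transfer k (sym_seq e (Suc n)) (2 * Suc n) (a, b) = ?l"
        unfolding transfer_sym_seq_Suc s_def[symmetric] by simp
      moreover have "fst ?l = fst ?rhs" "snd ?l = snd ?rhs"
        unfolding fst_conv snd_conv using inv sq by algebra+
      ultimately show ?thesis by (simp only: prod_eq_iff)
    qed
    \<comment> \<open>The vector \<open>(1, 0)\<close> picks out the first column, which identifies
      the entries found in \<open>E\<close>.\<close>
    have "transfer 0 (sym_seq e (Suc n)) (2 * Suc n) (1, 0) = (f (Suc n), g (Suc n))"
      unfolding transfer_f_eps_g_eps f_def g_def f_seq_def g_seq_def ..
    then have f: "f (Suc n) = f (n - 1) + lam_tilde * f n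
          + of_int s * lam_tilde * (M_pow s * g n + M_pow (- s) * bar (g n))"
        and g: "g (Suc n) = of_int s * M_pow (- s) * f n + M_pow (- s) * M_pow (- s) * bar (g n)"
      using E[of 0 1 0] by simp_all
    have "bar (g (Suc n)) = of_int s * M_pow s * f n + M_pow s * M_pow s * g n"
      using Suc.IH by (simp add: g bar_simps)
    \<comment> \<open>\<open>bar\<close> exchanges \<open>M_pow s * g n\<close> and
      \<open>M_pow (- s) * bar (g n)\<close>.\<close>
    moreover have "bar (f (Suc n)) = f (Suc n)"
      using Suc.IH by (simp add: f bar_simps add.commute)
    ultimately show ?case using E O Suc.IH f g by simp
  qed
  then show "even k \<Longrightarrow> ?E n k a b" "odd k \<Longrightarrow> ?O n k a b" "bar (f n) = f n" by simp_all
qed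

section \<open>Recursions for \<open>f_seq\<close> and \<open>g_seq\<close>\<close>

lemma f_g_seq_Suc:
  fixes n :: nat
  assumes signs: "\<forall>i\<ge>1. e i \<in> {-1, 1}"
  defines "s \<equiv> e (Suc n)"
  shows "f_seq e (Suc n) = f_seq e (n - 1) + lam_tilde * f_seq e n
      + of_int s * lam_tilde * (M_pow s * g_seq e n + M_pow (- s) * bar (g_seq e n))"
    and "g_seq e (Suc n) = of_int s * M_pow (- s) * f_seq e n + M_pow (- 2 * s) * bar (g_seq e n)"
proof -
  have s: "s \<in> {-1, 1}" using signs by (simp add: s_def)
  have inv: "M_pow s * M_pow (- s) = 1" and sq: "of_int s * of_int s = (1 :: laurent poly)"
    and dbl: "M_pow (- s) * M_pow (- s) = M_pow (- 2 * s)"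
    using s by (auto simp: M_pow_mult M_pow_0)
  have "(f_seq e (Suc n), g_seq e (Suc n)) = transfer 0 (sym_seq e (Suc n)) (2 * Suc n) (1, 0)"
    unfolding transfer_f_eps_g_eps f_seq_def g_seq_def ..
  \<comment> \<open>The first sign sends \<open>(1, 0)\<close> to
    \<open>(M_pow (- s), of_int s)\<close>; the inner block then starts at an odd offset.\<close>
  also have "\<dots> = transfer_step (2 * n + 2) s (transfer 1 (sym_seq e n) (2 * n) (M_pow (- s), of_int s))"
    unfolding transfer_sym_seq_Suc s_def by simp
  also have "transfer 1 (sym_seq e n) (2 * n) (M_pow (- s), of_int s)
      = (f_seq e (n - 1) * M_pow (- s) + lam_tilde * g_seq e n * of_int s,
         bar (g_seq e n) * M_pow (- s) + f_seq e n * of_int s)"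
    by (rule transfer_sym_seq(2)[OF signs]) simp_all
  finally have *: "f_seq e (Suc n) = M_pow s * (f_seq e (n - 1) * M_pow (- s) + lam_tilde * g_seq e n * of_int s)
        + of_int s * lam_tilde * (bar (g_seq e n) * M_pow (- s) + f_seq e n * of_int s)"
      "g_seq e (Suc n) = M_pow (- s) * (bar (g_seq e n) * M_pow (- s) + f_seq e n * of_int s)"
    by simp_all
  show "f_seq e (Suc n) = f_seq e (n - 1) + lam_tilde * f_seq e n
      + of_int s * lam_tilde * (M_pow s * g_seq e n + M_pow (- s) * bar (g_seq e n))"
    using *(1) inv sq by algebra
  show "g_seq e (Suc n) = of_int s * M_pow (- s) * f_seq e n + M_pow (- 2 * s) * bar (g_seq e n)"
    using *(2) dbl by algebra
qed

text \<open>The factor \<open>zz\<close> stays because it is not a unit in this ring.\<close>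

lemma zz_f_seq_diff:
  assumes signs: "\<forall>i\<ge>1. e i \<in> {-1, 1}"
  shows "zz * (f_seq e n - f_seq e (n - 1)) = lam_tilde * (bar (g_seq e n) - g_seq e n)"
proof (induction n)
  case 0
  show ?case by (simp add: g_seq_0 bar_0)
next
  case (Suc n)
  define s where "s = e (Suc n)"
  have s: "s \<in> {-1, 1}" using signs by (simp add: s_def)
  have inv: "M_pow s * M_pow (- s) = 1"
    and dbl: "M_pow (2 * s) = M_pow s * M_pow s" "M_pow (- 2 * s) = M_pow (- s) * M_pow (- s)"
    and z: "zz = of_int s * (M_pow s - M_pow (- s))" "of_int s * zz = M_pow s - M_pow (- s)"
    using s by (auto simp: M_pow_mult M_pow_0 zz_def)
  let ?F = "f_seq e n" and ?F' = "f_seq e (n - 1)" and ?G = "g_seq e n" and ?H = "bar (g_seq e n)"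
  note f = f_g_seq_Suc(1)[OF signs, where n = n, folded s_def]
  note g = f_g_seq_Suc(2)[OF signs, where n = n, folded s_def]
  have bar_g: "bar (g_seq e (Suc n)) = of_int s * M_pow s * ?F + M_pow s * M_pow s * ?G"
    unfolding g by (simp add: bar_simps transfer_sym_seq(3)[OF signs] dbl)
  have "zz * (f_seq e (Suc n) - ?F) = lam_tilde * (zz * ?F)
      + lam_tilde * (of_int s * zz) * (M_pow s * ?G + M_pow (- s) * ?H) - zz * (?F - ?F')"
    unfolding f by (simp add: algebra_simps)
  also have "\<dots> = lam_tilde * (of_int s * (M_pow s - M_pow (- s)) * ?F)
      + lam_tilde * (M_pow s - M_pow (- s)) * (M_pow s * ?G + M_pow (- s) * ?H)
      - lam_tilde * (?H - ?G)"
    by (simp only: Suc.IH z(2)) (simp only: z(1))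
  \<comment> \<open>The products with \<open>M_pow s * M_pow (- s) = 1\<close> leave
    \<open>?H - ?G\<close>, which the term from the induction hypothesis cancels.\<close>
  also have "\<dots> = lam_tilde * (bar (g_seq e (Suc n)) - g_seq e (Suc n))"
    unfolding bar_g unfolding g dbl using inv by algebra
  finally show ?case by simp
qed

lemma f_seq_Suc:
  fixes n :: nat
  assumes signs: "\<forall>i\<ge>1. e i \<in> {-1, 1}"
  defines "s \<equiv> e (Suc n)"
  shows "f_seq e (Suc n) = M_pow (2 * s) * f_seq e (n - 1)
      + (lam_tilde + 1 - M_pow (2 * s)) * f_seq e n
      + of_int s * lam_tilde * (M_pow 1 + M_pow (-1)) * bar (g_seq e n)"
proof -
  have s: "s \<in> {-1, 1}" using signs by (simp add: s_def)
  have inv: "M_pow s * M_pow (- s) = 1"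
    and dbl: "M_pow (2 * s) = M_pow s * M_pow s"
    and z: "of_int s * zz = M_pow s - M_pow (- s)"
    and tr: "M_pow 1 + M_pow (- 1) = M_pow s + M_pow (- s)"
    using s by (auto simp: M_pow_mult M_pow_0 zz_def)
  let ?F = "f_seq e n" and ?F' = "f_seq e (n - 1)" and ?G = "g_seq e n" and ?H = "bar (g_seq e n)"
  \<comment> \<open>This is the error made by replacing \<open>?G\<close> with \<open>?H\<close> in
    \<open>f_g_seq_Suc\<close>; it supplies the \<open>M_pow (2 * s)\<close> terms.\<close>
  have "of_int s * M_pow s * (lam_tilde * (?H - ?G)) = M_pow s * (of_int s * zz) * (?F - ?F')"
    unfolding zz_f_seq_diff[OF signs, symmetric] by (simp only: mult_ac)
  also have "\<dots> = (M_pow s * M_pow s - 1) * (?F - ?F')"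
    unfolding z using inv by algebra
  finally show ?thesis
    unfolding tr dbl f_g_seq_Suc(1)[OF signs, where n = n, folded s_def] by algebra
qed

section \<open>Unrolling the recursion for \<open>g_seq\<close>\<close>

lemma mu_self: "mu e n n = - e n"
  by (simp add: mu_def)

text \<open>The negation mirrors \<open>bar\<close>, the shift mirrors the factor
  \<open>M_pow (- 2 * e (Suc n))\<close> in the recursion for \<open>g_seq\<close>.\<close>

lemma mu_Suc:
  assumes "i \<le> n"
  shows "mu e (Suc n) i = - mu e n i - 2 * e (Suc n)"
proof -
  have "(\<Sum>j=i..n. (-1) ^ (Suc n - j) * e j) = - (\<Sum>j=i..n. (-1) ^ (n - j) * e j)"
    unfolding sum_negf[symmetric] by (rule sum.cong) (auto simp: Suc_diff_le)
  then show ?thesis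
    using assms by (simp add: mu_def Suc_diff_le)
qed

text \<open>The closed form is a premise so that the lemma serves both within the induction proving
  it and afterwards.\<close>

lemma bar_g_seq_sum:
  assumes signs: "\<forall>i\<ge>1. e i \<in> {-1, 1}"
    and "g_seq e n = (\<Sum>i=1..n. of_int (e i) * M_pow (mu e n i) * f_seq e (i - 1))"
  shows "bar (g_seq e n)
    = (\<Sum>i=1..n. of_int (e i) * M_pow (mu e (Suc n) i + 2 * e (Suc n)) * f_seq e (i - 1))"
  unfolding assms(2) bar_sum
  by (rule sum.cong) (auto simp: bar_simps transfer_sym_seq(3)[OF signs] mu_Suc)

lemma g_seq_sum:
  assumes signs: "\<forall>i\<ge>1. e i \<in> {-1, 1}"
  shows "g_seq e n = (\<Sum>i=1..n. of_int (e i) * M_pow (mu e n i) * f_seq e (i - 1))"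
proof (induction n)
  case 0
  show ?case by (simp add: g_seq_0)
next
  case (Suc n)
  let ?s = "e (Suc n)"
  have "M_pow (- 2 * ?s) * bar (g_seq e n)
      = (\<Sum>i=1..n. of_int (e i) * M_pow (mu e (Suc n) i) * f_seq e (i - 1))"
    unfolding bar_g_seq_sum[OF signs Suc.IH] sum_distrib_left
  proof (rule sum.cong[OF refl])
    fix i
    have "M_pow (- 2 * ?s) * M_pow (mu e (Suc n) i + 2 * ?s) = M_pow (mu e (Suc n) i)"
      by (simp add: M_pow_mult)
    from this[symmetric] show "M_pow (- 2 * ?s) * (of_int (e i) * M_pow (mu e (Suc n) i + 2 * ?s) * f_seq e (i - 1))
        = of_int (e i) * M_pow (mu e (Suc n) i) * f_seq e (i - 1)"
      by (simp only: mult_ac)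
  qed
  \<comment> \<open>The \<open>f_seq\<close> term of the recursion is the new summand
    \<open>i = Suc n\<close>, by \<open>mu_self\<close>.\<close>
  then show ?case
    by (simp add: f_g_seq_Suc(2)[OF signs] mu_self add.commute)
qed

theorem theorem6p4:
  fixes e :: "nat \<Rightarrow> int"
  assumes signs: "\<And>i. i \<ge> 1 \<Longrightarrow> e i \<in> {-1, 1}"
  shows
    "((\<forall>n\<ge>2. f_seq e n =
          M_pow (2 * e n) * f_seq e (n - 2)
          + (lam_tilde + 1 - M_pow (2 * e n)) * f_seq e (n - 1)
          + of_int (e n) * lam_tilde * (M_pow 1 + M_pow (-1)) * bar (g_seq e (n - 1))) \<and>
      (\<forall>n\<ge>1. g_seq e n =
          of_int (e n) * M_pow (- e n) * f_seq e (n - 1)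
          + M_pow (- 2 * e n) * bar (g_seq e (n - 1)))) \<and>
     ((\<forall>n\<ge>2. f_seq e n =
          (lam_tilde + 1 - M_pow (2 * e n)) * f_seq e (n - 1)
          + M_pow (2 * e n) * f_seq e (n - 2)
          + lam_tilde * (M_pow 1 + M_pow (-1)) *
            (\<Sum>i=1..n - 1. of_int (e n * e i) * M_pow (mu e n i + 2 * e n) * f_seq e (i - 1))) \<and>
      (\<forall>n\<ge>1. g_seq e n =
          (\<Sum>i=1..n. of_int (e i) * M_pow (mu e n i) * f_seq e (i - 1))))"
proof -
  have signs': "\<forall>i\<ge>1. e i \<in> {-1, 1}" using signs by blast
  have f: "f_seq e n = M_pow (2 * e n) * f_seq e (n - 2)
      + (lam_tilde + 1 - M_pow (2 * e n)) * f_seq e (n - 1)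
      + of_int (e n) * lam_tilde * (M_pow 1 + M_pow (-1)) * bar (g_seq e (n - 1))" if "n \<ge> 2" for n
  proof -
    from that obtain m where n: "n = Suc (Suc m)" by (metis add_2_eq_Suc le_Suc_ex)
    show ?thesis using f_seq_Suc[OF signs', where n = "Suc m"] by (simp add: n)
  qed
  have g: "g_seq e n = of_int (e n) * M_pow (- e n) * f_seq e (n - 1)
      + M_pow (- 2 * e n) * bar (g_seq e (n - 1))" if "n \<ge> 1" for n
    using that f_g_seq_Suc(2)[OF signs', where n = "n - 1"] by simp
  \<comment> \<open>This identity turns the recursion for \<open>f_seq\<close> in (i) into that in
    (ii).\<close>
  have sum: "(\<Sum>i=1..n - 1. of_int (e n * e i) * M_pow (mu e n i + 2 * e n) * f_seq e (i - 1))
      = of_int (e n) * bar (g_seq e (n - 1))" if "n \<ge> 2" for n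
  proof -
    have "Suc (n - 1) = n" using that by simp
    then show ?thesis
      using bar_g_seq_sum[OF signs' g_seq_sum[OF signs'], of "n - 1"]
      by (simp add: sum_distrib_left mult.assoc)
  qed
  have f': "f_seq e n = (lam_tilde + 1 - M_pow (2 * e n)) * f_seq e (n - 1)
      + M_pow (2 * e n) * f_seq e (n - 2)
      + lam_tilde * (M_pow 1 + M_pow (-1)) *
        (\<Sum>i=1..n - 1. of_int (e n * e i) * M_pow (mu e n i + 2 * e n) * f_seq e (i - 1))"
    if "n \<ge> 2" for n
    unfolding sum[OF that] using f[OF that] by algebra
  show ?thesis using f g f' g_seq_sum[OF signs'] by blast
qed

end
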